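(* Let $q\in\mathbb{C}$ with $0<|q|<1$, let $n\ge0$ be an integer and let $k$ be an integer with $0\le k\le\lfloor\frac n2\rfloor$. Then $$(1+q^{n+2})\,\mathcal{T}_{n+2}^{k}=\mathcal{U}_{n+2}^{k}+q^{2n+3}s\,\mathcal{U}_{n}^{k-1},$$ where $\mathcal{T}_m^k=\mathcal{T}_m^k(x,s,q)$ and $\mathcal{U}_m^k=\mathcal{U}_m^k(x,s,q)$ are the incomplete $q$-Chebyshev polynomials of the first and second kind.
   Context: Notation: $[n]_q=\frac{1-q^n}{1-q}$, $[0]_q=0$; $(a;q)_0=1$ and $(a;q)_n=\prod_{i=0}^{n-1}(1-q^i a)$; $\begin{bmatrix} n\\k\end{bmatrix}_q=\frac{(q;q)_n}{(q;q)_{n-k}(q;q)_k}$ for $0\le k\le n$, and it is $0$ for $n<k$. Here $x,s$ are indeterminates. For a nonnegative integer $n$ and $0\le k\le\lfloor n/2\rfloor$, the incomplete $q$-Chebyshev polynomials of the second kind are $$\mathcal{U}_n^k(x,s,q)=\sum_{j=0}^{k}q^{j^2}\begin{bmatrix} n-j\\ j\end{bmatrix}_q\frac{(-q;q)_{n-j}}{(-q;q)_j}\,s^jx^{n-2j},$$ with $\mathcal{U}_n^{-1}=0$ (empty sum). For $n\ge1$ and $0\le k\le\lfloor n/2\rfloor$, the incomplete $q$-Chebyshev polynomials of the first kind are $$\mathcal{T}_n^k(x,s,q)=\sum_{j=0}^{k}q^{j^2}\frac{[n]_q}{[n-j]_q}\begin{bmatrix} n-j\\ j\end{bmatrix}_q\frac{(-q;q)_{n-j-1}}{(-q;q)_j}\,s^jx^{n-2j}.$$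 *)

theory Defs
  imports Complex_Main "HOL-Computational_Algebra.Polynomial"
begin

definition q_number :: "complex \<Rightarrow> nat \<Rightarrow> complex" where
  "q_number q n = (1 - q ^ n) / (1 - q)"

definition q_poch :: "complex \<Rightarrow> complex \<Rightarrow> nat \<Rightarrow> complex" where
  "q_poch a q n = (\<Prod>i<n. 1 - q ^ i * a)"

definition q_binom :: "complex \<Rightarrow> nat \<Rightarrow> nat \<Rightarrow> complex" where
  "q_binom q n k =
     (if k \<le> n then q_poch q q n / (q_poch q q (n - k) * q_poch q q k) else 0)"

text \<open>
  Polynomials in two indeterminates over the complex numbers are represented
  as polynomials in \<open>s\<close> whose coefficients are polynomials in \<open>x\<close>.
\<close>

type_synonym poly_xs = "complex poly poly"

definition x_ind :: poly_xs where
  "x_ind = [:[:0, 1:]:]"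

definition s_ind :: poly_xs where
  "s_ind = [:0, 1:]"

definition scalar :: "complex \<Rightarrow> poly_xs" where
  "scalar c = [:[:c:]:]"

text \<open>
  The upper index \<open>k\<close> is an integer, so that \<open>k = -1\<close> gives the empty sum.
  The polynomials are meaningful for \<open>k \<le> int (n div 2)\<close> (and \<open>n \<ge> 1\<close> for the first kind);
  in this range all natural number subtractions below are exact.
\<close>

definition incomplete_q_cheb_U :: "nat \<Rightarrow> int \<Rightarrow> complex \<Rightarrow> poly_xs" where
  "incomplete_q_cheb_U n k q =
     (\<Sum>j\<in>{j::nat. int j \<le> k}.
        scalar (q ^ (j ^ 2) * q_binom q (n - j) j
                * (q_poch (- q) q (n - j) / q_poch (- q) q j))
        * s_ind ^ j * x_ind ^ (n - 2 * j))"

definition incomplete_q_cheb_T :: "nat \<Rightarrow> int \<Rightarrow> complex \<Rightarrow> poly_xs" where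
  "incomplete_q_cheb_T n k q =
     (\<Sum>j\<in>{j::nat. int j \<le> k}.
        scalar (q ^ (j ^ 2) * (q_number q n / q_number q (n - j)) * q_binom q (n - j) j
                * (q_poch (- q) q (n - j - 1) / q_poch (- q) q j))
        * s_ind ^ j * x_ind ^ (n - 2 * j))"

end

theory Submission
  imports Defs
begin

text \<open>
  Both sides are compared coefficientwise in \<open>s\<close>.  Put \<open>N = n + 2\<close>.  The extra factor \<open>s\<close>
  shifts the sum for \<open>U\<^sub>n\<close> by one, so that all three sums run over \<open>s\<^sup>j x\<^bsup>N-2j\<^esup>\<close> with
  \<open>0 \<le> j \<le> k\<close>, the last one without \<open>j = 0\<close>.  After dividing the coefficients by the common factor
  \<open>q\<^bsup>j*j\<^esup> [N-j choose j]\<^sub>q (-q;q)\<^bsub>N-j-1\<^esub> / (-q;q)\<^sub>j\<close>, where the shifted term is rewritten by the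
  absorption rule for \<open>q\<close>-binomials (lemma \<open>q_binom_absorption\<close>), what remains is
  \<open>(1 + q\<^bsup>N\<^esup>) (1 - q\<^bsup>N\<^esup>) / (1 - q\<^bsup>N-j\<^esup>)
    = (1 + q\<^bsup>N-j\<^esup>) + q\<^bsup>2(N-j)\<^esup> (1 - q\<^sup>j) (1 + q\<^sup>j) / (1 - q\<^bsup>N-j\<^esup>)\<close>,
  that is, \<open>1 - q\<^bsup>2N\<^esup> = (1 - q\<^bsup>2(N-j)\<^esup>) + q\<^bsup>2(N-j)\<^esup> (1 - q\<^bsup>2j\<^esup>)\<close>.  The condition
  \<open>|q| < 1\<close> makes all denominators nonzero.  The case \<open>j \<ge> 1\<close> is lemma \<open>coefficient_identity\<close>.
\<close>

lemma one_minus_power_nonzero: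
  fixes q :: complex
  assumes "cmod q < 1"
  shows "1 - q ^ Suc i \<noteq> 0"
proof
  assume "1 - q ^ Suc i = 0"
  then have "cmod q ^ Suc i = 1"
    by (metis eq_iff_diff_eq_0 norm_one norm_power)
  then have "cmod q = 1"
    using power_eq_1_iff[of "cmod q" "Suc i"] by simp
  with assms show False
    by simp
qed

lemma one_plus_power_nonzero:
  fixes q :: complex
  assumes "cmod q < 1"
  shows "1 + q ^ Suc i \<noteq> 0"
proof
  assume "1 + q ^ Suc i = 0"
  then have "cmod q ^ Suc i = 1"
    by (metis add_eq_0_iff norm_minus_cancel norm_one norm_power)
  then have "cmod q = 1"
    using power_eq_1_iff[of "cmod q" "Suc i"] by simp
  with assms show False
    by simp
qed

lemma q_poch_0: "q_poch a q 0 = 1"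
  by (simp add: q_poch_def)

lemma q_poch_Suc_same: "q_poch q q (Suc m) = q_poch q q m * (1 - q ^ Suc m)"
  by (simp add: q_poch_def mult.commute)

lemma q_poch_Suc_minus: "q_poch (- q) q (Suc m) = q_poch (- q) q m * (1 + q ^ Suc m)"
  by (simp add: q_poch_def mult.commute)

lemma q_poch_same_nonzero:
  assumes "cmod q < 1"
  shows "q_poch q q m \<noteq> 0"
  by (induction m) (simp_all only: q_poch_0 q_poch_Suc_same mult_eq_0_iff
      one_minus_power_nonzero[OF assms] not_False_eq_True simp_thms one_neq_zero)

lemma q_poch_minus_nonzero:
  assumes "cmod q < 1"
  shows "q_poch (- q) q m \<noteq> 0"
  by (induction m) (simp_all only: q_poch_0 q_poch_Suc_minus mult_eq_0_iff
      one_plus_power_nonzero[OF assms] not_False_eq_True simp_thms one_neq_zero)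

lemma q_binom_absorption:
  assumes "cmod q < 1"
  shows "(1 - q ^ Suc i) * q_binom q (Suc m) (Suc i) = (1 - q ^ Suc m) * q_binom q m i"
proof (cases "i \<le> m")
  case True
  have "q_binom q (Suc m) (Suc i)
      = (q_poch q q m * (1 - q ^ Suc m))
        / (q_poch q q (m - i) * (q_poch q q i * (1 - q ^ Suc i)))"
    using True by (simp only: q_binom_def Suc_le_mono if_True diff_Suc_Suc q_poch_Suc_same)
  moreover have "q_binom q m i = q_poch q q m / (q_poch q q (m - i) * q_poch q q i)"
    using True by (simp add: q_binom_def)
  ultimately show ?thesis
    using one_minus_power_nonzero[OF assms, of i] q_poch_same_nonzero[OF assms]
    by (simp del: power_Suc)
qed (simp add: q_binom_def)

text \<open>
  The comparison of the coefficients of \<open>s\<^sup>j\<close> for \<open>j = i + 1\<close>, in the variables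
  \<open>i\<close> and \<open>m = N - j - 1\<close>, so that \<open>n = m + i\<close>.
\<close>

lemma coefficient_identity:
  assumes "cmod q < 1"
  shows "(1 + q ^ (m + i + 2))
      * (q ^ (Suc i)\<^sup>2 * (q_number q (m + i + 2) / q_number q (Suc m))
         * q_binom q (Suc m) (Suc i) * (q_poch (- q) q m / q_poch (- q) q (Suc i)))
    = q ^ (Suc i)\<^sup>2 * q_binom q (Suc m) (Suc i)
        * (q_poch (- q) q (Suc m) / q_poch (- q) q (Suc i))
      + q ^ (2 * (m + i) + 3)
        * (q ^ i\<^sup>2 * q_binom q m i * (q_poch (- q) q m / q_poch (- q) q i))"
proof -
  define a where "a = q ^ Suc m"
  define b where "b = q ^ Suc i"
  define B where "B = q_binom q (Suc m) (Suc i)"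
  define P where "P = q_poch (- q) q m"
  define R where "R = q_poch (- q) q i"
  define c where "c = q ^ (Suc i)\<^sup>2"
  have a: "1 - a \<noteq> 0" and b: "1 + b \<noteq> 0" and R: "R \<noteq> 0"
    using one_minus_power_nonzero[OF assms] one_plus_power_nonzero[OF assms]
      q_poch_minus_nonzero[OF assms]
    by (auto simp: a_def b_def R_def simp del: power_Suc)
  have q: "1 - q \<noteq> 0"
    using assms by auto
  have ab: "q ^ (m + i + 2) = a * b"
    by (simp add: a_def b_def power_add power2_eq_square)
  have number: "q_number q (m + i + 2) / q_number q (Suc m) = (1 - a * b) / (1 - a)"
    using q a unfolding q_number_def ab a_def[symmetric] by simp
  have binom: "q_binom q m i = (1 - b) * B / (1 - a)"
    using q_binom_absorption[OF assms, of i m] a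
    unfolding a_def[symmetric] b_def[symmetric] B_def[symmetric] by (simp add: field_simps)
  have "2 * (m + i) + 3 + i\<^sup>2 = (Suc i)\<^sup>2 + Suc m * 2"
    by (simp add: power2_eq_square)
  then have exponent: "q ^ (2 * (m + i) + 3) * q ^ i\<^sup>2 = c * a\<^sup>2"
    by (metis a_def c_def power_add power_mult)
  have rhs: "q ^ (2 * (m + i) + 3) * (q ^ i\<^sup>2 * q_binom q m i * (P / R))
      = c * a\<^sup>2 * ((1 - b) * B / (1 - a)) * (P / R)"
    unfolding exponent[symmetric] binom by simp
  have "(1 + a * b) * (c * ((1 - a * b) / (1 - a)) * B * (P / (R * (1 + b))))
      = c * B * (P * (1 + a) / (R * (1 + b))) + c * a\<^sup>2 * ((1 - b) * B / (1 - a)) * (P / R)"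
    using a b R by (simp add: divide_simps) (simp add: algebra_simps power2_eq_square)
  then show ?thesis
    unfolding number ab q_poch_Suc_minus B_def[symmetric] P_def[symmetric] R_def[symmetric]
      c_def[symmetric] a_def[symmetric] b_def[symmetric] rhs .
qed

lemma scalar_add: "scalar (a + b) = scalar a + scalar b"
  by (simp add: scalar_def)

lemma scalar_mult: "scalar (a * b) = scalar a * scalar b"
  by (simp add: scalar_def)

theorem theorem7:
  fixes q :: complex and n :: nat and k :: int
  assumes "0 < cmod q" and "cmod q < 1"
    and "0 \<le> k" and "k \<le> int (n div 2)"
  shows "scalar (1 + q ^ (n + 2)) * incomplete_q_cheb_T (n + 2) k q
       = incomplete_q_cheb_U (n + 2) k q
         + scalar (q ^ (2 * n + 3)) * s_ind * incomplete_q_cheb_U n (k - 1) q"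
proof -
  define K where "K = nat k"
  have K: "K \<le> n div 2"
    using assms K_def by simp
  have sets: "{j::nat. int j \<le> k} = {..<Suc K}" "{j::nat. int j \<le> k - 1} = {..<K}"
    using assms by (auto simp: K_def)
  define t where "t j = q ^ (j ^ 2) * (q_number q (n + 2) / q_number q (n + 2 - j))
      * q_binom q (n + 2 - j) j * (q_poch (- q) q (n + 2 - j - 1) / q_poch (- q) q j)" for j
  define u where "u m j = q ^ (j ^ 2) * q_binom q (m - j) j
      * (q_poch (- q) q (m - j) / q_poch (- q) q j)" for m j
  have coeff_0: "(1 + q ^ (n + 2)) * t 0 = u (n + 2) 0"
  proof -
    have "q_number q (n + 2) \<noteq> 0"
      using one_minus_power_nonzero[OF assms(2), of "Suc n"] assms(2)
      by (auto simp: q_number_def)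
    moreover have "q_poch (- q) q (n + 2) = q_poch (- q) q (n + 1) * (1 + q ^ (n + 2))"
      using q_poch_Suc_minus[of q "n + 1"] by simp
    ultimately show ?thesis
      by (simp add: t_def u_def)
  qed
  have coeff_Suc: "(1 + q ^ (n + 2)) * t (Suc i) = u (n + 2) (Suc i) + q ^ (2 * n + 3) * u n i"
    if "i < K" for i
  proof -
    from that K have "i \<le> n"
      by linarith
    then obtain m where n: "n = m + i"
      by (metis add.commute le_Suc_ex)
    show ?thesis
      using coefficient_identity[OF assms(2), of m i] by (simp add: n t_def u_def)
  qed
  have shift: "scalar (1 + q ^ (n + 2)) * (scalar (t (Suc i)) * s_ind ^ Suc i
        * x_ind ^ (n + 2 - 2 * Suc i))
      = scalar (u (n + 2) (Suc i)) * s_ind ^ Suc i * x_ind ^ (n + 2 - 2 * Suc i)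
        + scalar (q ^ (2 * n + 3)) * s_ind * (scalar (u n i) * s_ind ^ i * x_ind ^ (n - 2 * i))"
    if "i < K" for i
  proof -
    have "scalar (1 + q ^ (n + 2)) * scalar (t (Suc i))
        = scalar (u (n + 2) (Suc i)) + scalar (q ^ (2 * n + 3)) * scalar (u n i)"
      using coeff_Suc[OF that] by (metis scalar_add scalar_mult)
    moreover have "n + 2 - 2 * Suc i = n - 2 * i"
      by simp
    moreover have "a * (t' * S * X) = u' * S * X + b * s_ind * (v * S' * X)"
      if "a * t' = u' + b * v" "S = s_ind * S'" for a t' u' b v S S' X :: poly_xs
    proof -
      have "a * (t' * S * X) = (a * t') * S * X"
        by (simp only: mult.assoc)
      then show ?thesis
        unfolding that by (simp only: distrib_left distrib_right mult_ac)
    qed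
    ultimately show ?thesis
      by (simp only: power_Suc)
  qed
  have "scalar (1 + q ^ (n + 2)) * incomplete_q_cheb_T (n + 2) k q
      = scalar (1 + q ^ (n + 2)) * (scalar (t 0) * s_ind ^ 0 * x_ind ^ (n + 2 - 2 * 0))
        + (\<Sum>i<K. scalar (1 + q ^ (n + 2)) * (scalar (t (Suc i)) * s_ind ^ Suc i
            * x_ind ^ (n + 2 - 2 * Suc i)))"
    unfolding incomplete_q_cheb_T_def sets t_def[symmetric] sum.lessThan_Suc_shift
      distrib_left sum_distrib_left ..
  also have "\<dots> = scalar (u (n + 2) 0) * s_ind ^ 0 * x_ind ^ (n + 2 - 2 * 0)
      + (\<Sum>i<K. scalar (u (n + 2) (Suc i)) * s_ind ^ Suc i * x_ind ^ (n + 2 - 2 * Suc i)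
        + scalar (q ^ (2 * n + 3)) * s_ind * (scalar (u n i) * s_ind ^ i * x_ind ^ (n - 2 * i)))"
    unfolding coeff_0[symmetric] scalar_mult mult.assoc[symmetric]
    by (intro arg_cong2[of _ _ _ _ "(+)"] refl sum.cong) (use shift in \<open>simp add: mult.assoc\<close>)
  also have "\<dots> = incomplete_q_cheb_U (n + 2) k q
      + scalar (q ^ (2 * n + 3)) * s_ind * incomplete_q_cheb_U n (k - 1) q"
    unfolding incomplete_q_cheb_U_def sets u_def[symmetric] sum.lessThan_Suc_shift
      sum.distrib sum_distrib_left add.assoc ..
  finally show ?thesis .
qed

end
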